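(* Let $d \ge 0$ be an integer and let $p_0, p_1, \dots, p_d$ be distinct positive integers with $p_d \mid p_{d-1} \mid \cdots \mid p_0$. Let $$\Delta = \operatorname{conv}\left\{ \left(\tfrac{1}{p_0},0,\dots,0\right), \left(0,\tfrac{1}{p_1},0,\dots,0\right), \dots, \left(0,\dots,0,\tfrac{1}{p_d}\right)\right\} \subset \mathbb{R}^{d+1},$$ a $d$-dimensional simplex, and write its Ehrhart quasi-polynomial as $L_\Delta(k) = c_d(k)\,k^d + c_{d-1}(k)\,k^{d-1} + \dots + c_0(k)$ with $c_0,\dots,c_d$ periodic. Then for every $j = 0,1,\dots,d$ the coefficient function $c_j$ has minimum period $p_j$, and $p_j$ is the $j$-index of $\Delta$.
   Context: A quasi-polynomial is a function on $\mathbb{Z}$ of the form $q(k) = c_d(k)k^d + \dots + c_0(k)$ where $c_0,\dots,c_d$ are periodic functions of $k\in\mathbb{Z}$, called the coefficient functions of $q$ (they are uniquely determined by $q$, even by its values at positive integers). The minimum period of a periodic function $c:\mathbb{Z}\to\mathbb{C}$ is the smallest positive integer $p$ with $c(k+p)=c(k)$ for all $k\in\mathbb{Z}$. A rational polytope $\mathcal{P}\subset\mathbb{R}^n$ is the convex hull of finitely many points of $\mathbb{Q}^n$; its dimension $d$ is the dimension of its affine span. Ehrhart's theorem: the function $L_{\mathcal{P}}(k) := \#(k\mathcal{P}\cap\mathbb{Z}^n)$, $k\in\mathbb{Z}_{>0}$, agrees with a (unique) quasi-polynomial of degree $d$, called the Ehrhart quasi-polynomial of $\mathcal{P}$ and again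 denoted $L_{\mathcal{P}}$. For $0\le j\le d$, the $j$-index of a rational $d$-dimensional polytope $\mathcal{P}$ is the minimal positive integer $p_j$ such that the affine span of every $j$-dimensional face of $p_j\mathcal{P}$ contains a point of $\mathbb{Z}^n$ (the polytope itself is regarded as its $d$-dimensional face). *)

theory Defs
  imports "HOL-Analysis.Analysis"
begin

definition is_period :: "(int \<Rightarrow> complex) \<Rightarrow> nat \<Rightarrow> bool" where
  "is_period c p \<longleftrightarrow> p > 0 \<and> (\<forall>k. c (k + int p) = c k)"

definition periodic :: "(int \<Rightarrow> complex) \<Rightarrow> bool" where
  "periodic c \<longleftrightarrow> (\<exists>p. is_period c p)"

text \<open>Only meaningful for periodic functions.\<close>

definition min_period :: "(int \<Rightarrow> complex) \<Rightarrow> nat" where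
  "min_period c = (LEAST p. is_period c p)"

definition integer_points :: "(real ^ 'n) set" where
  "integer_points = {x. \<forall>i. x $ i \<in> \<int>}"

definition dilate :: "nat \<Rightarrow> (real ^ 'n) set \<Rightarrow> (real ^ 'n) set" where
  "dilate k P = (\<lambda>x. real k *\<^sub>R x) ` P"

definition lattice_count :: "(real ^ 'n) set \<Rightarrow> nat \<Rightarrow> nat" where
  "lattice_count P k = card (dilate k P \<inter> integer_points)"

text \<open>The functions \<open>c 0, \<dots>, c d\<close> are the coefficient functions of a quasi-polynomial that
  agrees with the lattice point count of \<open>P\<close> at all positive integers. Periodicity determines
  them on all of \<open>\<int>\<close> from this; values of \<open>c j\<close> for \<open>j > d\<close> are irrelevant.\<close>

definition ehrhart_coeffs :: "(real ^ 'n) set \<Rightarrow> nat \<Rightarrow> (nat \<Rightarrow> int \<Rightarrow> complex) \<Rightarrow> bool" where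
  "ehrhart_coeffs P d c \<longleftrightarrow>
     (\<forall>j\<le>d. periodic (c j)) \<and>
     (\<forall>k>0. of_nat (lattice_count P k) = (\<Sum>j\<le>d. c j (int k) * of_nat k ^ j))"

text \<open>For a polytope, the geometric faces are exactly the sets \<open>F\<close> with \<open>F face_of P\<close>; these
  include \<open>P\<close> itself, and the empty face is excluded below because its dimension is \<open>-1\<close>.\<close>

definition j_index :: "(real ^ 'n) set \<Rightarrow> nat \<Rightarrow> nat" where
  "j_index P j = (LEAST q. q > 0 \<and>
     (\<forall>F. F face_of dilate q P \<and> aff_dim F = int j \<longrightarrow> affine hull F \<inter> integer_points \<noteq> {}))"

text \<open>The enumeration \<open>\<iota>\<close> of the index type tells which coordinate of \<open>real ^ 'n\<close> counts as the
  \<open>i\<close>-th one, for \<open>i = 0, \<dots>, d\<close>.\<close>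

definition axis_simplex :: "(nat \<Rightarrow> 'n::finite) \<Rightarrow> nat \<Rightarrow> (nat \<Rightarrow> nat) \<Rightarrow> (real ^ 'n) set" where
  "axis_simplex \<iota> d p = convex hull {axis (\<iota> i) (1 / real (p i)) | i. i \<le> d}"

end

theory Submission
  imports Defs "HOL-Computational_Algebra.Polynomial"
begin

text \<open>Lattice points of \<open>k \<Delta>\<close> are the representations \<open>k = \<Sum>i\<le>d. p i * m i\<close> with \<open>m i \<ge> 0\<close>; let \<open>R d k\<close>
  be their number. Then \<open>R d k - R d (k - p d) = R (d - 1) k\<close>. Comparing coefficients in this
  identity, a downward induction on \<open>j\<close> shows that \<open>c j\<close> has period \<open>p j\<close>. The minimality of this
  period follows from the stronger fact that the discrete Fourier coefficient of \<open>c j\<close> at a primitive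
  \<open>p j\<close>-th root of unity is nonzero, which for \<open>j < d\<close> is inherited from \<open>d - 1\<close> since functions
  whose period is a proper divisor of \<open>p j\<close> do not contribute to this coefficient. For \<open>j = d\<close> it
  equals \<open>c d 0\<close>, because \<open>R d\<close> is supported on the multiples of \<open>p d\<close>; if it vanished, then \<open>c d\<close>
  would, and summing the recursion for \<open>c (d - 1)\<close> over a period would contradict the case \<open>d - 1\<close>.\<close>

section \<open>Periodic functions and uniqueness of quasi-polynomial coefficients\<close>

lemma is_period_shift:
  assumes "is_period c p" "int p dvd l"
  shows "c (k + l) = c k"
proof -
  have pos: "c (x + int n * int p) = c x" for x n
  proof (induction n)
    case (Suc n)
    have "c (x + int (Suc n) * int p) = c ((x + int n * int p) + int p)"
      by (simp add: algebra_simps)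
    then show ?case using Suc assms(1) by (simp only: is_period_def)
  qed simp
  obtain t where t: "l = int p * t" using assms(2) by (elim dvdE)
  show ?thesis
  proof (cases "t \<ge> 0")
    case True
    then show ?thesis using pos[of k "nat t"] t by (simp add: mult.commute)
  next
    case False
    then show ?thesis using pos[of "k + l" "nat (- t)"] t by (simp add: mult.commute)
  qed
qed

lemma is_period_dvd:
  assumes "is_period c p" "p dvd q" "q > 0"
  shows "is_period c q"
  using assms is_period_shift[OF assms(1), of "int q"] by (simp add: is_period_def)

lemma common_period:
  fixes d :: nat
  assumes "\<forall>j\<le>d. periodic (c j)"
  obtains N where "N > 0" "\<forall>j\<le>d. is_period (c j) N"
proof -
  obtain f where f: "\<And>j. j \<le> d \<Longrightarrow> is_period (c j) (f j)"
    using assms unfolding periodic_def by metis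
  have pos: "(\<Prod>j\<le>d. f j) > 0" using f by (auto simp: is_period_def intro!: prod_pos)
  have "is_period (c j) (\<Prod>j\<le>d. f j)" if "j \<le> d" for j
    using that by (intro is_period_dvd[OF f[OF that] _ pos] dvd_prodI) auto
  then show thesis using that[OF pos] by blast
qed

text \<open>On the residue class of \<open>k\<close> modulo \<open>N\<close> the coefficients are
  constant, so the sum is there an honest polynomial \<open>Q\<close> with infinitely many
  roots.\<close>

lemma quasi_poly_eq_0:
  assumes per: "\<forall>j\<le>d. is_period (c j) N"
    and zero: "\<And>k::nat. k > K \<Longrightarrow> (\<Sum>j\<le>d. c j (int k) * of_nat k ^ j) = 0"
    and "j \<le> d"
  shows "c j k = 0"
proof -
  define Q where "Q = (\<Sum>i\<le>d. monom (c i k) i)"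
  have N: "N > 0" using per by (auto simp: is_period_def)
  \<comment> \<open>Integers congruent to \<open>k\<close> modulo \<open>N\<close>; the offset
    \<open>\<bar>k\<bar> + int K + 1\<close> pushes all of them beyond \<open>K\<close>, even when
    \<open>k\<close> is negative.\<close>
  define f where "f n = k + (\<bar>k\<bar> + int K + 1 + int n) * int N" for n
  have f_gt: "f n > int K" for n
  proof -
    have "(\<bar>k\<bar> + int K + 1 + int n) * int N \<ge> (\<bar>k\<bar> + int K + 1 + int n) * 1"
      using N by (intro mult_left_mono) auto
    then have "f n \<ge> k + (\<bar>k\<bar> + int K + 1 + int n)" by (simp only: f_def mult_1_right add_left_mono)
    then show ?thesis by linarith
  qed
  have root: "poly Q (of_int (f n)) = 0" for n
  proof -
    have "c i (f n) = c i k" if "i \<le> d" for i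
      unfolding f_def using per that by (intro is_period_shift) auto
    then have "poly Q (of_int (f n)) =
        (\<Sum>i\<le>d. c i (int (nat (f n))) * of_nat (nat (f n)) ^ i)"
      using f_gt[of n] by (simp add: Q_def poly_sum poly_monom)
    also have "\<dots> = 0" using f_gt[of n] by (intro zero) auto
    finally show ?thesis .
  qed
  have "inj (\<lambda>n. of_int (f n) :: complex)"
    using N by (auto simp: inj_def f_def)
  then have "infinite (range (\<lambda>n. of_int (f n) :: complex))"
    by (rule range_inj_infinite)
  moreover have "range (\<lambda>n. of_int (f n) :: complex) \<subseteq> {x. poly Q x = 0}" using root by auto
  ultimately have "Q = 0" using poly_roots_finite finite_subset by blast
  moreover have "coeff Q j = c j k"
    using \<open>j \<le> d\<close> by (simp add: Q_def coeff_sum)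
  ultimately show ?thesis by simp
qed

text \<open>The difference has a common period and vanishes beyond \<open>K\<close>. The threshold
  lets the lemma serve identities involving \<open>k - s\<close>, which hold only for
  \<open>k > s\<close>.\<close>

lemma quasi_poly_unique:
  assumes "\<forall>j\<le>d. periodic (b j)" "\<forall>j\<le>d. periodic (c j)"
    and eq: "\<And>k::nat. k > K \<Longrightarrow>
      (\<Sum>j\<le>d. b j (int k) * of_nat k ^ j) = (\<Sum>j\<le>d. c j (int k) * of_nat k ^ j)"
    and "j \<le> d"
  shows "b j = c j"
proof
  fix k
  obtain M where M: "M > 0" "\<forall>j\<le>d. is_period (b j) M" using common_period[OF assms(1)] by blast
  obtain N where N: "N > 0" "\<forall>j\<le>d. is_period (c j) N" using common_period[OF assms(2)] by blast
  have "is_period (b i) (M * N)" "is_period (c i) (M * N)" if "i \<le> d" for i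
    using M N that by (auto intro: is_period_dvd)
  then have "\<forall>i\<le>d. is_period (\<lambda>k. b i k - c i k) (M * N)" by (simp add: is_period_def)
  then have "b j k - c j k = 0"
    by (rule quasi_poly_eq_0[where c = "\<lambda>j k. b j k - c j k" and K = K])
       (use eq \<open>j \<le> d\<close> in \<open>simp_all add: left_diff_distrib sum_subtractf\<close>)
  then show "b j k = c j k" by simp
qed

section \<open>Fourier coefficients and minimum periods\<close>

definition root_char :: "nat \<Rightarrow> int \<Rightarrow> complex" where
  "root_char p k = cis (2 * pi * of_int k / of_nat p)"

text \<open>The unnormalised discrete Fourier coefficient at \<open>root_char p\<close>, a character
  of exact order \<open>p\<close>.\<close>

definition primitive_fourier :: "nat \<Rightarrow> (int \<Rightarrow> complex) \<Rightarrow> complex" where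
  "primitive_fourier p c = (\<Sum>k<p. c (int k) * root_char p (int k))"

lemma root_char_add: "root_char p (k + l) = root_char p k * root_char p l"
  by (simp add: root_char_def cis_mult add_divide_distrib ring_distribs)

lemma root_char_eq_1_iff:
  assumes "p > 0"
  shows "root_char p k = 1 \<longleftrightarrow> int p dvd k"
proof -
  \<comment> \<open>On the unit circle, real part 1 already forces the value 1.\<close>
  have "root_char p k = 1 \<longleftrightarrow> cos (2 * pi * of_int k / of_nat p) = 1"
    unfolding root_char_def by (auto simp: complex_eq_iff cos_one_sin_zero)
  also have "\<dots> \<longleftrightarrow> (\<exists>n::int. 2 * pi * of_int k / of_nat p = of_int n * 2 * pi)"
    by (simp add: cos_one_2pi_int)
  also have "\<dots> \<longleftrightarrow> (\<exists>n::int. real_of_int k = of_int (int p * n))"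
    using assms by (intro ex_cong1) (auto simp: field_simps)
  also have "\<dots> \<longleftrightarrow> int p dvd k" unfolding of_int_eq_iff dvd_def by blast
  finally show ?thesis .
qed

text \<open>Moving the window by one drops \<open>f x\<close> and gains
  \<open>f (x + int p)\<close>, which are equal; two-sided induction covers negative shifts.\<close>

lemma sum_period_shift:
  assumes "is_period f p"
  shows "(\<Sum>k<p. f (int k + l)) = (\<Sum>k<p. f (int k))"
proof -
  have step: "(\<Sum>k<p. f (int k + (x + 1))) = (\<Sum>k<p. f (int k + x))" for x
  proof -
    have "(\<Sum>k<p. f (int k + (x + 1))) + f x = (\<Sum>k<Suc p. f (int k + x))"
      unfolding sum.lessThan_Suc_shift by (simp add: algebra_simps)
    also have "\<dots> = (\<Sum>k<p. f (int k + x)) + f x"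
      using assms by (simp add: is_period_def add.commute)
    finally show ?thesis by simp
  qed
  show ?thesis
  proof (induction l rule: int_induct[where k = 0])
    case (step2 i)
    then show ?case using step[of "i - 1"] by simp
  qed (use step in auto)
qed

text \<open>The summand \<open>c k * root_char p k\<close> is itself \<open>p\<close>-periodic, so
  translating it by \<open>l\<close> keeps its sum, while the character splits off the factor
  \<open>root_char p l\<close>.\<close>

lemma primitive_fourier_shift:
  assumes "is_period c p"
  shows "primitive_fourier p (\<lambda>k. c (k + l)) * root_char p l = primitive_fourier p c"
proof -
  have "root_char p (int p) = 1" using assms root_char_eq_1_iff by (auto simp: is_period_def)
  then have "is_period (\<lambda>k. c k * root_char p k) p"
    using assms by (auto simp: is_period_def root_char_add)
  from sum_period_shift[OF this, of l] show ?thesis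
    by (simp add: primitive_fourier_def sum_distrib_right root_char_add mult.assoc)
qed

text \<open>Translation by the period \<open>q\<close> fixes \<open>c\<close> but scales the
  coefficient by a root of unity; as the coefficient is nonzero, that root of unity is 1.\<close>

lemma primitive_fourier_nonzero_dvd:
  assumes "is_period c p" "is_period c q" "primitive_fourier p c \<noteq> 0"
  shows "p dvd q"
proof -
  have "(\<lambda>k. c (k + int q)) = c" using assms(2) by (simp add: is_period_def fun_eq_iff)
  then have "root_char p (int q) = 1" using primitive_fourier_shift[OF assms(1), of "int q"] assms(3)
    by simp
  then show ?thesis using root_char_eq_1_iff[of p] assms(1) by (auto simp: is_period_def)
qed

lemma min_period_eqI:
  assumes "is_period c p" "primitive_fourier p c \<noteq> 0"
  shows "min_period c = p"
  unfolding min_period_def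
proof (rule Least_equality[where P = "is_period c", OF assms(1)])
  fix q assume q: "is_period c q"
  then have "p dvd q" using primitive_fourier_nonzero_dvd assms by blast
  then show "p \<le> q" using q by (auto simp: is_period_def intro: dvd_imp_le)
qed

text \<open>Only \<open>k = 0\<close> among the residues below \<open>p\<close> is a multiple of
  \<open>p\<close>, so a single summand survives.\<close>

lemma primitive_fourier_supported:
  assumes "p > 0" "\<And>k. \<not> int p dvd k \<Longrightarrow> c k = 0"
  shows "primitive_fourier p c = c 0"
proof -
  have "primitive_fourier p c = (\<Sum>k\<in>{0}. c (int k) * root_char p (int k))"
    unfolding primitive_fourier_def using assms
    by (intro sum.mono_neutral_right) (auto dest: nat_dvd_not_less)
  then show ?thesis by (simp add: root_char_def)
qed

section \<open>Counting representations by the parts \<open>p 0, ..., p d\<close>\<close>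

text \<open>Multiplicities are functions on all of \<open>nat\<close> that vanish beyond
  \<open>d\<close>, so each representation is encoded once and those for \<open>d\<close> are also
  representations for \<open>Suc d\<close>.\<close>

definition representations :: "(nat \<Rightarrow> nat) \<Rightarrow> nat \<Rightarrow> nat \<Rightarrow> (nat \<Rightarrow> nat) set" where
  "representations p d k = {m. (\<forall>i>d. m i = 0) \<and> (\<Sum>i\<le>d. p i * m i) = k}"

definition num_representations :: "(nat \<Rightarrow> nat) \<Rightarrow> nat \<Rightarrow> nat \<Rightarrow> nat" where
  "num_representations p d k = card (representations p d k)"

lemma finite_representations:
  assumes "\<forall>i\<le>d. p i > 0"
  shows "finite (representations p d k)"
proof (rule finite_subset)
  show "representations p d k \<subseteq> {m. \<forall>i. (i \<in> {..d} \<longrightarrow> m i \<in> {..k}) \<and> (i \<notin> {..d} \<longrightarrow> m i = 0)}"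
  proof (intro subsetI CollectI allI conjI impI)
    fix m i assume m: "m \<in> representations p d k" and i: "i \<in> {..d}"
    have "m i \<le> p i * m i" using assms i by (cases "p i") auto
    also have "\<dots> \<le> (\<Sum>i\<le>d. p i * m i)" using i by (intro member_le_sum) auto
    also have "\<dots> = k" using m by (simp add: representations_def)
    finally show "m i \<in> {..k}" by simp
  qed (auto simp: representations_def)
  show "finite {m. \<forall>i. (i \<in> {..d} \<longrightarrow> m i \<in> {..k}) \<and> (i \<notin> {..d} \<longrightarrow> m i = 0)}"
    by (rule finite_set_of_finite_funs) auto
qed

lemma num_representations_0:
  assumes "p 0 > 0"
  shows "num_representations p 0 k = (if p 0 dvd k then 1 else 0)"
proof (cases "p 0 dvd k")
  case True
  then obtain t where t: "k = p 0 * t" by (elim dvdE)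
  have "representations p 0 k = {\<lambda>i. if i = 0 then t else 0}"
    using assms t by (auto simp: representations_def fun_eq_iff)
  then show ?thesis using True by (simp add: num_representations_def)
next
  case False
  then have "representations p 0 k = {}" by (auto simp: representations_def)
  then show ?thesis using False by (simp add: num_representations_def)
qed

text \<open>Representations of \<open>k + p (Suc d)\<close> either avoid the last part or use it at least once.\<close>

lemma num_representations_Suc:
  assumes "\<forall>i\<le>Suc d. p i > 0"
  shows "num_representations p (Suc d) (k + p (Suc d)) =
    num_representations p (Suc d) k + num_representations p d (k + p (Suc d))"
proof -
  let ?h = "\<lambda>m::nat \<Rightarrow> nat. m(Suc d := Suc (m (Suc d)))"
  have split: "representations p (Suc d) (k + p (Suc d)) =
      ?h ` representations p (Suc d) k \<union> representations p d (k + p (Suc d))" (is "?L = ?A \<union> ?B")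
  proof safe
    fix m assume m: "m \<in> ?L" "m \<notin> ?B"
    have "m (Suc d) \<noteq> 0"
    proof
      assume "m (Suc d) = 0"
      then have "m i = 0" if "i > d" for i
        using m(1) that by (cases "i = Suc d") (auto simp: representations_def)
      then show False using m \<open>m (Suc d) = 0\<close> by (simp add: representations_def)
    qed
    then obtain t where t: "m (Suc d) = Suc t" by (cases "m (Suc d)") auto
    have "m = ?h (m(Suc d := t))" using t by (auto simp: fun_eq_iff)
    moreover have "m(Suc d := t) \<in> representations p (Suc d) k"
      using m(1) t by (auto simp: representations_def)
    ultimately show "m \<in> ?A" by blast
  qed (auto simp: representations_def)
  have disj: "?A \<inter> ?B = {}" by (auto simp: representations_def)
  have inj: "inj_on ?h (representations p (Suc d) k)"
    by (auto simp: inj_on_def fun_eq_iff split: if_splits)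
  show ?thesis
    unfolding num_representations_def split
    using disj finite_representations[OF assms] finite_representations[of d p] assms
    by (subst card_Un_disjoint) (auto simp: card_image[OF inj])
qed

text \<open>Along the divisibility chain \<open>p d\<close> divides every part, hence every
  representable number.\<close>

lemma num_representations_not_dvd:
  assumes "\<forall>i<d. p (Suc i) dvd p i" "\<not> p d dvd k"
  shows "num_representations p d k = 0"
proof -
  have "p d dvd p i" if "i \<le> d" for i
    using that assms(1) by (induction rule: inc_induct) (auto intro: dvd_trans)
  then have "p d dvd (\<Sum>i\<le>d. p i * m i)" for m
    by (intro dvd_sum dvd_mult2) auto
  then have "representations p d k = {}" using assms(2) by (auto simp: representations_def)
  then show ?thesis by (simp add: num_representations_def)
qed

section \<open>Power sums and quasi-polynomiality of the count\<close>

text \<open>Telescoping \<open>(i + 1) ^ Suc j - i ^ Suc j\<close> and expanding binomially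
  expresses the \<open>j\<close>-th power sum through \<open>n ^ Suc j\<close> and the lower power
  sums.\<close>

lemma power_sum_poly:
  "\<exists>Q::complex poly. degree Q \<le> Suc j \<and> (\<forall>n. poly Q (of_nat n) = (\<Sum>i<n. of_nat i ^ j))"
proof (induction j rule: less_induct)
  case (less j)
  then obtain Q where Q: "\<And>l. l < j \<Longrightarrow> degree (Q l) \<le> Suc l"
    "\<And>l n. l < j \<Longrightarrow> poly (Q l :: complex poly) (of_nat n) = (\<Sum>i<n. of_nat i ^ l)"
    by metis
  \<comment> \<open>The telescoped identity solved for the \<open>j\<close>-th power sum, whose
    factor there is \<open>Suc j choose j\<close>, that is \<open>Suc j\<close>.\<close>
  define R where "R = smult (1 / of_nat (Suc j))
     (monom 1 (Suc j) - (\<Sum>l<j. smult (of_nat (Suc j choose l)) (Q l)))"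
  have "degree (\<Sum>l<j. smult (of_nat (Suc j choose l)) (Q l)) \<le> Suc j"
    by (intro degree_sum_le) (auto intro!: order_trans[OF degree_smult_le] order_trans[OF Q(1)])
  then have "degree R \<le> Suc j"
    unfolding R_def by (intro order_trans[OF degree_smult_le] degree_diff_le) (auto simp: degree_monom_le)
  moreover have "poly R (of_nat n) = (\<Sum>i<n. of_nat i ^ j)" for n
  proof -
    have "of_nat n ^ Suc j = (\<Sum>i<n. of_nat (Suc i) ^ Suc j - of_nat i ^ Suc j :: complex)"
      by (subst sum_lessThan_telescope) simp
    also have "\<dots> = (\<Sum>i<n. \<Sum>l\<le>j. of_nat (Suc j choose l) * of_nat i ^ l)"
    proof (rule sum.cong[OF refl])
      fix i
      have "of_nat (Suc i) ^ Suc j = (of_nat i + 1 :: complex) ^ Suc j" by (simp add: add.commute)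
      also have "\<dots> = (\<Sum>l\<le>Suc j. of_nat (Suc j choose l) * of_nat i ^ l)"
        by (subst binomial_ring) simp
      finally show "of_nat (Suc i) ^ Suc j - of_nat i ^ Suc j =
        (\<Sum>l\<le>j. of_nat (Suc j choose l) * of_nat i ^ l :: complex)" by (simp del: of_nat_Suc)
    qed
    also have "\<dots> = (\<Sum>l\<le>j. of_nat (Suc j choose l) * (\<Sum>i<n. of_nat i ^ l))"
      by (subst sum.swap) (simp add: sum_distrib_left)
    also have "\<dots> = (\<Sum>l<j. of_nat (Suc j choose l) * poly (Q l) (of_nat n)) +
        of_nat (Suc j) * (\<Sum>i<n. of_nat i ^ j)"
      unfolding lessThan_Suc_atMost[symmetric] by (simp add: Q(2))
    finally show ?thesis
      unfolding R_def by (simp add: poly_sum poly_monom field_simps del: of_nat_Suc)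
  qed
  ultimately show ?case by blast
qed

lemma sum_poly_poly:
  assumes "degree (q :: complex poly) \<le> d"
  shows "\<exists>Q::complex poly. degree Q \<le> Suc d \<and> (\<forall>n. poly Q (of_nat n) = (\<Sum>i<n. poly q (of_nat i)))"
proof -
  obtain S where S: "\<And>j. degree (S j :: complex poly) \<le> Suc j"
    "\<And>j n. poly (S j) (of_nat n) = (\<Sum>i<n. of_nat i ^ j)"
    using power_sum_poly by metis
  define Q where "Q = (\<Sum>j\<le>d. smult (coeff q j) (S j))"
  have "degree Q \<le> Suc d"
    unfolding Q_def using S(1)
    by (intro degree_sum_le) (auto intro!: order_trans[OF degree_smult_le] order_trans[OF S(1)])
  moreover have "poly Q (of_nat n) = (\<Sum>i<n. poly q (of_nat i))" for n
  proof -
    have "poly q x = (\<Sum>j\<le>d. coeff q j * x ^ j)" for x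
      using assms by (simp add: poly_altdef coeff_eq_0 sum.mono_neutral_left[of "{..d}" "{..degree q}"])
    then have "(\<Sum>i<n. poly q (of_nat i)) = (\<Sum>j\<le>d. coeff q j * (\<Sum>i<n. of_nat i ^ j))"
      by (simp add: sum_distrib_left) (rule sum.swap)
    then show ?thesis by (simp add: Q_def poly_sum S(2))
  qed
  ultimately show ?thesis by blast
qed

text \<open>The polynomial is in the position \<open>n\<close> within the class, and
  \<open>r\<close> may exceed \<open>N\<close>, so that any \<open>r + Suc i * s\<close> can serve
  as a starting point.\<close>

definition poly_on_residues :: "nat \<Rightarrow> nat \<Rightarrow> (nat \<Rightarrow> complex) \<Rightarrow> bool" where
  "poly_on_residues N d f \<longleftrightarrow> (\<forall>r. \<exists>P. degree P \<le> d \<and> (\<forall>n. f (r + n * N) = poly P (of_nat n)))"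

lemma poly_on_residues_antidifference:
  assumes f: "poly_on_residues N d f" and "s dvd N"
    and g: "\<And>k. g (k + s) = g k + f (k + s)"
  shows "poly_on_residues N (Suc d) g"
  unfolding poly_on_residues_def
proof
  fix r
  obtain t where t: "N = t * s" using \<open>s dvd N\<close> by (metis dvdE mult.commute)
  obtain P where P: "\<And>r. degree (P r) \<le> d" "\<And>r n. f (r + n * N) = poly (P r) (of_nat n)"
    using f unfolding poly_on_residues_def by metis
  \<comment> \<open>Advancing by \<open>N\<close> takes \<open>t\<close> steps of length
    \<open>s\<close>; \<open>q\<close> collects the values of \<open>f\<close> added on the way.
    Summing \<open>q\<close> over \<open>n\<close> raises the degree bound by one.\<close>
  define q where "q = (\<Sum>i<t. P (r + Suc i * s))"
  have "degree q \<le> d" unfolding q_def by (intro degree_sum_le) (auto simp: P(1))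
  then obtain Q where Q: "degree Q \<le> Suc d" "\<And>n. poly Q (of_nat n) = (\<Sum>i<n. poly q (of_nat i))"
    using sum_poly_poly by blast
  have iter: "g (k + m * s) = g k + (\<Sum>i<m. f (k + Suc i * s))" for k m
  proof (induction m)
    case (Suc m)
    have "k + Suc m * s = (k + m * s) + s" by simp
    then have "g (k + Suc m * s) = g (k + m * s) + f (k + Suc m * s)" using g by presburger
    then show ?case using Suc by simp
  qed simp
  have step: "g (r + Suc n * N) = g (r + n * N) + poly q (of_nat n)" for n
    using iter[of "r + n * N" t]
    by (simp add: q_def poly_sum P(2)[symmetric] t algebra_simps)
  have "g (r + n * N) = poly ([:g r:] + Q) (of_nat n)" for n
    by (induction n) (simp_all add: Q(2) step del: mult_Suc of_nat_Suc of_nat_0)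
  moreover have "degree ([:g r:] + Q) \<le> Suc d" using Q(1) by (intro degree_add_le) auto
  ultimately show "\<exists>P. degree P \<le> Suc d \<and> (\<forall>n. g (r + n * N) = poly P (of_nat n))" by blast
qed

lemma poly_on_residues_coeffs:
  assumes "poly_on_residues N d f" "N > 0"
  obtains c where "\<And>j. is_period (c j) N"
    "\<And>k. f k = (\<Sum>j\<le>d. c j (int k) * of_nat k ^ j)"
proof -
  obtain P where P: "\<And>r. degree (P r) \<le> d" "\<And>r n. f (r + n * N) = poly (P r) (of_nat n)"
    using assms(1) unfolding poly_on_residues_def by metis
  \<comment> \<open>The substitution \<open>n = (k - r) / N\<close> turns a polynomial in
    \<open>n\<close> into one in the argument \<open>k\<close> itself.\<close>
  define R where "R r = pcompose (P r) [:- of_nat r / of_nat N, 1 / of_nat N:]" for r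
  define c where "c j k = coeff (R (nat (k mod int N))) j" for j k
  have "degree (R r) \<le> d" for r
  proof -
    have "degree (R r) \<le> degree (P r) * 1"
      unfolding R_def by (intro order_trans[OF degree_pcompose_le] mult_left_mono) auto
    then show ?thesis using P(1)[of r] by simp
  qed
  then have R: "poly (R r) x = (\<Sum>j\<le>d. coeff (R r) j * x ^ j)" for r x
    by (simp add: poly_altdef coeff_eq_0 sum.mono_neutral_left[of "{..d}" "{..degree (R r)}"])
  have "f k = (\<Sum>j\<le>d. c j (int k) * of_nat k ^ j)" for k
  proof -
    have "of_nat k = of_nat (k mod N) + (of_nat (k div N) * of_nat N :: complex)"
      unfolding of_nat_mult[symmetric] of_nat_add[symmetric] by simp
    then have "of_nat (k div N) = - of_nat (k mod N) / of_nat N + of_nat k * (1 / of_nat N :: complex)"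
      using \<open>N > 0\<close> by (simp add: field_simps)
    then have "poly (R (k mod N)) (of_nat k) = poly (P (k mod N)) (of_nat (k div N))"
      by (simp add: R_def poly_pcompose)
    also have "\<dots> = f k" using P(2)[of "k mod N" "k div N"] by simp
    finally show ?thesis by (simp add: R c_def nat_mod_distrib flip: of_nat_mod)
  qed
  moreover have "is_period (c j) N" for j using \<open>N > 0\<close> by (simp add: is_period_def c_def)
  ultimately show thesis using that by blast
qed

lemma dvd_chain:
  fixes p :: "nat \<Rightarrow> nat"
  assumes "\<forall>i<d. p (Suc i) dvd p i" "i \<le> j" "j \<le> d"
  shows "p j dvd p i"
  using assms(2,3,1) by (induction rule: dec_induct) (auto intro: dvd_trans)

text \<open>The modulus \<open>p 0\<close> can stay fixed through the induction because every step
  length \<open>p (Suc d)\<close> divides it.\<close>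

lemma poly_on_residues_num_representations:
  assumes "\<forall>i\<le>d. p i > 0" "\<forall>i<d. p (Suc i) dvd p i"
  shows "poly_on_residues (p 0) d (\<lambda>k. of_nat (num_representations p d k))"
  using assms
proof (induction d)
  case 0
  have "degree [:of_nat (num_representations p 0 r):] \<le> 0 \<and>
    (\<forall>n. of_nat (num_representations p 0 (r + n * p 0)) =
      poly [:of_nat (num_representations p 0 r):] (of_nat n))" for r
    using 0 by (simp add: num_representations_0)
  then show ?case unfolding poly_on_residues_def by blast
next
  case (Suc d)
  then show ?case
    by (intro poly_on_residues_antidifference[where s = "p (Suc d)"])
       (auto simp: num_representations_Suc intro: dvd_chain)
qed

lemma num_representations_quasi_poly:
  assumes "\<forall>i\<le>d. p i > 0" "\<forall>i<d. p (Suc i) dvd p i"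
  obtains c where "\<forall>j\<le>d. periodic (c j)"
    "\<And>k. of_nat (num_representations p d k) = (\<Sum>j\<le>d. c j (int k) * of_nat k ^ j)"
  using poly_on_residues_coeffs[OF poly_on_residues_num_representations[OF assms]] assms(1)
  unfolding periodic_def by (metis le0)

section \<open>Support and difference equations for coefficient functions\<close>

text \<open>Replacing each coefficient by zero off the multiples of \<open>s\<close> does not change
  the values of the quasi-polynomial, so by uniqueness it does not change the coefficients.\<close>

lemma quasi_poly_supported:
  assumes c: "\<forall>j\<le>d. periodic (c j)"
    and eq: "\<And>k::nat. k > 0 \<Longrightarrow> f k = (\<Sum>j\<le>d. c j (int k) * of_nat k ^ j)"
    and f: "\<And>k. \<not> s dvd k \<Longrightarrow> f k = 0"
    and "s > 0" "j \<le> d" "\<not> int s dvd k"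
  shows "c j k = 0"
proof -
  define b where "b i k = (if int s dvd k then c i k else 0)" for i k
  have "periodic (b i)" if i: "i \<le> d" for i
  proof -
    obtain N where N: "is_period (c i) N" using c i by (auto simp: periodic_def)
    have "is_period (c i) (N * s)"
      using N \<open>s > 0\<close> by (intro is_period_dvd[OF N]) (auto simp: is_period_def)
    then have "is_period (b i) (N * s)" by (simp add: is_period_def b_def)
    then show ?thesis by (auto simp: periodic_def)
  qed
  moreover have "(\<Sum>i\<le>d. b i (int k) * of_nat k ^ i) = (\<Sum>i\<le>d. c i (int k) * of_nat k ^ i)"
    if "k > 0" for k
    using eq[OF that] f[of k] by (cases "s dvd k") (simp_all add: b_def)
  ultimately have "b j = c j" using c \<open>j \<le> d\<close> by (intro quasi_poly_unique[of d b c 0]) blast+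
  then have "c j k = b j k" by simp
  then show ?thesis using \<open>\<not> int s dvd k\<close> by (simp add: b_def)
qed

lemma shifted_power_sum:
  fixes a :: "nat \<Rightarrow> complex"
  shows "(\<Sum>i\<le>d. a i * (x - y) ^ i) =
    (\<Sum>j\<le>d. (\<Sum>i=j..d. of_nat (i choose j) * (- y) ^ (i - j) * a i) * x ^ j)"
proof -
  have "(\<Sum>i\<le>d. a i * (x - y) ^ i) =
      (\<Sum>i\<le>d. \<Sum>j\<le>i. of_nat (i choose j) * (- y) ^ (i - j) * a i * x ^ j)"
  proof (rule sum.cong[OF refl])
    fix i
    have "(x - y) ^ i = (x + - y) ^ i" by simp
    also have "\<dots> = (\<Sum>j\<le>i. of_nat (i choose j) * x ^ j * (- y) ^ (i - j))"
      by (rule binomial_ring)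
    finally show "a i * (x - y) ^ i =
        (\<Sum>j\<le>i. of_nat (i choose j) * (- y) ^ (i - j) * a i * x ^ j)"
      by (simp add: sum_distrib_left mult_ac)
  qed
  also have "\<dots> = (\<Sum>j\<le>d. \<Sum>i=j..d. of_nat (i choose j) * (- y) ^ (i - j) * a i * x ^ j)"
    unfolding sum.Sigma[OF finite_atMost ballI, OF finite_atMost]
      sum.Sigma[OF finite_atMost ballI, OF finite_atLeastAtMost]
    by (rule sum.reindex_bij_witness[of _ prod.swap prod.swap]) auto
  finally show ?thesis by (simp add: sum_distrib_right)
qed

text \<open>Comparing coefficients in \<open>g k - g (k - s) = f k\<close>.\<close>

lemma quasi_poly_difference_coeffs:
  assumes b: "\<forall>j\<le>d. periodic (b j)" and c: "\<forall>j\<le>d. periodic (c j)"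
    and f: "\<And>k::nat. k > 0 \<Longrightarrow> f k = (\<Sum>j\<le>d. b j (int k) * of_nat k ^ j)"
    and g: "\<And>k::nat. k > 0 \<Longrightarrow> g k = (\<Sum>j\<le>d. c j (int k) * of_nat k ^ j)"
    and fg: "\<And>k. g (k + s) = g k + f (k + s)"
    and "j \<le> d"
  shows "b j k = c j k -
    (\<Sum>i=j..d. of_nat (i choose j) * (- of_nat s) ^ (i - j) * c i (k - int s))"
proof -
  define e where "e j k = c j k -
    (\<Sum>i=j..d. of_nat (i choose j) * (- of_nat s) ^ (i - j) * c i (k - int s))" for j k
  obtain N where N: "N > 0" "\<forall>j\<le>d. is_period (c j) N" using common_period[OF c] by blast
  have "is_period (e i) N" if "i \<le> d" for i
  proof -
    have "c l (k + int N - int s) = c l (k - int s)" if "l \<le> d" for l k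
      using is_period_shift[of "c l" N "int N" "k - int s"] N that by (simp add: algebra_simps)
    then show ?thesis using N that by (simp add: is_period_def e_def)
  qed
  then have "\<forall>j\<le>d. periodic (e j)" by (auto simp: periodic_def)
  \<comment> \<open>The bound \<open>k > s\<close> keeps \<open>k - s\<close> positive, where
    \<open>g\<close> is known to be given by \<open>c\<close>; it becomes the threshold for
    uniqueness.\<close>
  moreover have "(\<Sum>j\<le>d. b j (int k) * of_nat k ^ j) = (\<Sum>j\<le>d. e j (int k) * of_nat k ^ j)"
    if "k > s" for k
  proof -
    have "(\<Sum>j\<le>d. b j (int k) * of_nat k ^ j) = g k - g (k - s)"
      using f[of k] fg[of "k - s"] that by simp
    also have "g (k - s) = (\<Sum>i\<le>d. c i (int k - int s) * (of_nat k - of_nat s) ^ i)"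
      using g[of "k - s"] that by (simp add: of_nat_diff)
    finally show ?thesis
      using that by (simp add: g e_def shifted_power_sum left_diff_distrib sum_subtractf)
  qed
  ultimately have "b j = e j" using b \<open>j \<le> d\<close> by (intro quasi_poly_unique[of d b e s]) auto
  then show ?thesis by (simp add: e_def)
qed

text \<open>The defect \<open>h\<close> has period \<open>s\<close>, hence period \<open>p\<close>,
  so \<open>c\<close> grows linearly with slope \<open>h k\<close> along \<open>k + n p\<close>; a
  periodic function allows only slope zero.\<close>

lemma is_period_of_difference:
  assumes "periodic c" "is_period (\<lambda>k. c k - c (k - int s)) p" "s dvd p"
  shows "is_period c p"
proof -
  define h where "h k = c (k + int p) - c k" for k
  have p: "p > 0" using assms(2) by (simp add: is_period_def)
  have "c (k + int p) - c (k + int p - int s) = c k - c (k - int s)" for k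
    using assms(2) by (simp add: is_period_def)
  then have "h (k - int s) = h k" for k by (simp add: h_def algebra_simps)
  from this[of "k + int s" for k] have "is_period h s"
    using p \<open>s dvd p\<close> by (auto simp: is_period_def intro: dvd_pos_nat)
  then have h: "h (k + int n * int p) = h k" for k n
    using \<open>s dvd p\<close> by (intro is_period_shift) auto
  have iter: "c (k + int n * int p) = c k + of_nat n * h k" for k n
  proof (induction n)
    case (Suc n)
    have "c (k + int (Suc n) * int p) = c (k + int n * int p) + h (k + int n * int p)"
      by (simp add: h_def algebra_simps)
    then show ?case using Suc h by (simp add: algebra_simps)
  qed simp
  obtain N where N: "is_period c N" using assms(1) by (auto simp: periodic_def)
  have "h k = 0" for k
    using iter[of k N] is_period_shift[OF N, of "int N * int p" k] N by (simp add: is_period_def)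
  then show ?thesis using p by (simp add: is_period_def h_def)
qed

text \<open>A nonzero coefficient would make \<open>p\<close> divide the smaller positive number
  \<open>q\<close>.\<close>

lemma primitive_fourier_eq_0:
  assumes "is_period c q" "q dvd p" "q < p"
  shows "primitive_fourier p c = 0"
  using primitive_fourier_nonzero_dvd[of c p q] is_period_dvd[OF assms(1,2)] assms(1,3)
  by (auto simp: is_period_def dest: nat_dvd_not_less)

lemma is_period_translate: "is_period c p \<Longrightarrow> is_period (\<lambda>k. c (k - l)) p"
  by (simp add: is_period_def add_diff_eq[symmetric] add.commute[of _ "int p"])

section \<open>Induction on the dimension for the coefficient periods\<close>

text \<open>Minimality is carried as a nonvanishing Fourier coefficient, a condition linear in
  \<open>c j\<close> that can be traced through the recursion.\<close>

lemma coeff_periods_num_representations: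
  assumes "\<forall>i\<le>d. p i > 0" "\<forall>i<d. p (Suc i) dvd p i" "inj_on p {0..d}"
    and "\<forall>j\<le>d. periodic (c j)"
    and "\<And>k::nat. k > 0 \<Longrightarrow>
      of_nat (num_representations p d k) = (\<Sum>j\<le>d. c j (int k) * of_nat k ^ j)"
    and "j \<le> d"
  shows "is_period (c j) (p j) \<and> primitive_fourier (p j) (c j) \<noteq> 0"
  using assms
proof (induction d arbitrary: c j)
  case 0
  have "c 0 = (\<lambda>k. if int (p 0) dvd k then 1 else 0)"
  proof (rule quasi_poly_unique[of 0 c "\<lambda>_ k. if int (p 0) dvd k then 1 else 0" 0 0])
    have "is_period (\<lambda>k. if int (p 0) dvd k then 1 else 0) (p 0)"
      using 0 by (simp add: is_period_def)
    then show "\<forall>j\<le>0. periodic (\<lambda>k. if int (p 0) dvd k then 1 else 0)"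
      by (auto simp: periodic_def)
  qed (use "0.prems"(4) "0.prems"(1) "0.prems"(5)[symmetric] in
        \<open>auto simp: num_representations_0\<close>)
  then show ?case using 0 by (simp add: is_period_def primitive_fourier_supported)
next
  case (Suc d)
  let ?P = "p (Suc d)"
  have p_pos: "p i > 0" if "i \<le> Suc d" for i using Suc.prems that by blast
  have chain: "p l dvd p i" if "i \<le> l" "l \<le> Suc d" for i l
    using dvd_chain[OF Suc.prems(2)] that by blast
  \<comment> \<open>Injectivity of \<open>p\<close> makes every divisibility in the chain
    proper.\<close>
  have strict: "p l < p i" if "i < l" "l \<le> Suc d" for i l
    using dvd_imp_le[OF chain[of i l]] p_pos[of i] inj_onD[OF Suc.prems(3), of l i] that by force
  obtain b where b: "\<forall>j\<le>d. periodic (b j)"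
    "\<And>k. of_nat (num_representations p d k) = (\<Sum>j\<le>d. b j (int k) * of_nat k ^ j)"
    using num_representations_quasi_poly[of d p] Suc.prems by auto
  have IH: "is_period (b i) (p i) \<and> primitive_fourier (p i) (b i) \<noteq> 0" if "i \<le> d" for i
    using Suc.prems b that by (intro Suc.IH) (auto intro: inj_on_subset)
  \<comment> \<open>Padding by a zero coefficient at \<open>Suc d\<close> gives both sides of the
    recursion the same formal degree.\<close>
  define b' where "b' j = (if j \<le> d then b j else (\<lambda>k. 0))" for j
  have "is_period (\<lambda>k. 0) 1" by (simp add: is_period_def)
  then have "\<forall>j\<le>Suc d. periodic (b' j)" using b(1) by (auto simp: b'_def periodic_def)
  then have coeffs: "b' i k = c i k -
      (\<Sum>l=i..Suc d. of_nat (l choose i) * (- of_nat ?P) ^ (l - i) * c l (k - int ?P))"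
    if "i \<le> Suc d" for i k
    using b(2) Suc.prems that
    by (intro quasi_poly_difference_coeffs[where f = "\<lambda>k. of_nat (num_representations p d k)"
          and g = "\<lambda>k. of_nat (num_representations p (Suc d) k)"])
       (auto simp: b'_def num_representations_Suc)
  \<comment> \<open>The contribution of the degrees above \<open>i\<close>; the term
    \<open>l = i\<close> is the translate of \<open>c i\<close> that moves to the left-hand
    side.\<close>
  define t where "t i k =
    (\<Sum>l=Suc i..Suc d. of_nat (l choose i) * (- of_nat ?P) ^ (l - i) * c l (k - int ?P))" for i k
  have coeffs: "c i k - c i (k - int ?P) = b' i k + t i k" if "i \<le> Suc d" for i k
    using coeffs[OF that, of k, unfolded sum.atLeast_Suc_atMost[OF that]]
    by (simp add: t_def algebra_simps del: sum.cl_ivl_Suc)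
  have t_period: "is_period (t i) (p (Suc i))"
    if i: "i \<le> d" and c: "\<And>l. i < l \<Longrightarrow> l \<le> Suc d \<Longrightarrow> is_period (c l) (p l)" for i
  proof -
    have "is_period (\<lambda>k. c l (k - int ?P)) (p (Suc i))" if l: "l \<in> {Suc i..Suc d}" for l
    proof -
      have "is_period (c l) (p l)" using l by (intro c) auto
      moreover have "p l dvd p (Suc i)" using l by (intro chain) auto
      moreover have "p (Suc i) > 0" using i by (intro p_pos) auto
      ultimately show ?thesis by (intro is_period_translate[OF is_period_dvd])
    qed
    then show ?thesis
      using p_pos[of "Suc i"] i unfolding is_period_def t_def by (auto intro!: sum.cong)
  qed
  \<comment> \<open>Downward induction on \<open>i\<close>: \<open>b' i\<close> is controlled by
    dimension \<open>d\<close> and \<open>t i\<close> by higher coefficients. At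
    \<open>i = Suc d\<close> both vanish.\<close>
  have c_period: "is_period (c i) (p i)" if "i \<le> Suc d" for i
    using that
  proof (induction i rule: measure_induct_rule[where f = "\<lambda>i. Suc d - i"])
    case (less i)
    have "is_period (b' i) (p i)"
      using IH[of i] p_pos[of i] less.prems by (auto simp: b'_def is_period_def)
    moreover have "is_period (t i) (p i)"
    proof (cases "i \<le> d")
      case True
      then show ?thesis
        using less.IH p_pos by (intro is_period_dvd[OF t_period] chain) auto
    next
      case False
      then show ?thesis using less.prems p_pos by (simp add: t_def is_period_def)
    qed
    ultimately have "is_period (\<lambda>k. c i k - c i (k - int ?P)) (p i)"
      using coeffs[OF less.prems] by (simp add: is_period_def)
    then show ?case
      using Suc.prems(4) less.prems by (auto intro: chain is_period_of_difference[of "c i" ?P])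
  qed
  have supp_c: "c (Suc d) k = 0" if "\<not> int ?P dvd k" for k
    using Suc.prems that num_representations_not_dvd[of "Suc d" p]
    by (intro quasi_poly_supported[where c = c and s = ?P and d = "Suc d"
          and f = "\<lambda>k. of_nat (num_representations p (Suc d) k)"]) auto
  have supp_b: "b d k = 0" if "\<not> int (p d) dvd k" for k
    using Suc.prems that num_representations_not_dvd[of d p] b
    by (intro quasi_poly_supported[where c = b and s = "p d" and d = d
          and f = "\<lambda>k. of_nat (num_representations p d k)"]) auto
  have "primitive_fourier (p j) (c j) \<noteq> 0"
  proof (cases "j \<le> d")
    case True
    let ?F = "primitive_fourier (p j)"
    \<comment> \<open>The period \<open>p (Suc j)\<close> of \<open>t j\<close> is a proper divisor
      of \<open>p j\<close>.\<close>
    have "?F (t j) = 0"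
      using c_period True by (intro primitive_fourier_eq_0[OF t_period] chain strict) auto
    moreover have "?F (\<lambda>k. c j k - c j (k - int ?P)) = ?F (\<lambda>k. b' j k + t j k)"
      using coeffs[of j] True by simp
    ultimately have "?F (c j) - ?F (\<lambda>k. c j (k + - int ?P)) = ?F (b j)"
      using True by (simp add: primitive_fourier_def b'_def sum_subtractf sum.distrib
          left_diff_distrib ring_distribs)
    \<comment> \<open>If the coefficient of \<open>c j\<close> vanished, so would that of its
      translate, and then that of \<open>b j\<close>, against the induction hypothesis.\<close>
    moreover have "?F (\<lambda>k. c j (k + - int ?P)) = 0" if "?F (c j) = 0"
      using primitive_fourier_shift[OF c_period, of j "- int ?P"] True that
      by (simp add: root_char_def)
    ultimately show ?thesis using IH[OF True] by auto
  next
    case False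
    then have j: "j = Suc d" using Suc.prems by simp
    \<comment> \<open>Otherwise \<open>c (Suc d)\<close> is identically zero and \<open>t d\<close>,
      whose only term is \<open>l = Suc d\<close>, vanishes. Then \<open>b d\<close> is a difference
      of translates of \<open>c d\<close> and sums to zero over a period; but that sum is
      \<open>b d 0\<close>, its nonzero Fourier coefficient.\<close>
    have "c (Suc d) 0 \<noteq> 0"
    proof
      assume 0: "c (Suc d) 0 = 0"
      have "c (Suc d) k = 0" for k
        using supp_c[of k] is_period_shift[OF c_period, of "Suc d" k 0] 0 by auto
      then have "c d k - c d (k + - int ?P) = b d k" for k
        using coeffs[of d k] by (simp add: t_def b'_def)
      then have "(\<Sum>k<p d. b d (int k)) = 0"
        using sum_period_shift[OF c_period, of d "- int ?P"]
        by (simp add: sum_subtractf flip: \<open>\<And>k. c d k - c d (k + - int ?P) = b d k\<close>)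
      moreover have "(\<Sum>k<p d. b d (int k)) = (\<Sum>k\<in>{0}. b d (int k))"
        using p_pos[of d] by (intro sum.mono_neutral_right) (auto intro!: supp_b dest: nat_dvd_not_less)
      ultimately show False
        using IH[of d] primitive_fourier_supported[of "p d" "b d"] supp_b p_pos by simp
    qed
    then show ?thesis
      using j supp_c p_pos primitive_fourier_supported[of ?P "c (Suc d)"] by simp
  qed
  then show ?case using c_period Suc.prems by blast
qed

section \<open>Geometry of the dilated simplex: faces, lattice points and indices\<close>

definition scaled_vertex :: "(nat \<Rightarrow> 'n::finite) \<Rightarrow> (nat \<Rightarrow> nat) \<Rightarrow> nat \<Rightarrow> nat \<Rightarrow> real ^ 'n" where
  "scaled_vertex \<iota> p q i = axis (\<iota> i) (real q / real (p i))"

lemma dilate_axis_simplex: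
  "dilate q (axis_simplex \<iota> d p) = convex hull (scaled_vertex \<iota> p q ` {..d})"
proof -
  have "scaled_vertex \<iota> p q ` {..d} =
      (*\<^sub>R) (real q) ` {axis (\<iota> i) (1 / real (p i)) | i. i \<le> d}"
  proof -
    have "scaled_vertex \<iota> p q i = real q *\<^sub>R axis (\<iota> i) (1 / real (p i))" for i
      by (simp add: scaled_vertex_def vec_eq_iff axis_def)
    then show ?thesis by auto
  qed
  then show ?thesis
    by (simp add: dilate_def axis_simplex_def convex_hull_scaling)
qed

text \<open>The vertices are nonzero multiples of distinct coordinate vectors, hence orthogonal and
  linearly independent.\<close>

lemma scaled_vertex_independent:
  assumes "inj_on \<iota> {..d}" "\<forall>i\<le>d. p i > 0" "q > 0"
  shows "inj_on (scaled_vertex \<iota> p q) {..d}"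
    and "\<not> affine_dependent (scaled_vertex \<iota> p q ` {..d})"
proof -
  show "inj_on (scaled_vertex \<iota> p q) {..d}"
    using assms by (intro inj_onI) (force simp: scaled_vertex_def axis_eq_axis dest: inj_onD)
  have "pairwise orthogonal (scaled_vertex \<iota> p q ` {..d})"
    using inj_onD[OF assms(1)]
    by (fastforce simp: pairwise_def scaled_vertex_def orthogonal_def inner_axis_axis)
  moreover have "0 \<notin> scaled_vertex \<iota> p q ` {..d}"
    using assms by (auto simp: scaled_vertex_def axis_eq_0_iff)
  ultimately show "\<not> affine_dependent (scaled_vertex \<iota> p q ` {..d})"
    using pairwise_orthogonal_independent affine_dependent_imp_dependent by blast
qed

lemma scaled_vertex_nth:
  assumes "inj_on \<iota> {..d}" "i \<le> d" "l \<le> d"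
  shows "scaled_vertex \<iota> p q i $ \<iota> l = (if i = l then real q / real (p i) else 0)"
  using inj_on_eq_iff[OF assms(1), of i l] assms(2,3)
  by (auto simp: scaled_vertex_def axis_def)

text \<open>This description by inequalities and one equation is what turns lattice points into
  representations of \<open>q\<close>.\<close>

lemma convex_hull_scaled_vertices:
  fixes \<iota> :: "nat \<Rightarrow> 'n::finite"
  assumes "bij_betw \<iota> {..d} UNIV" "\<forall>i\<le>d. p i > 0" "q > 0"
  shows "convex hull (scaled_vertex \<iota> p q ` {..d}) =
    {x. (\<forall>i\<le>d. 0 \<le> x $ \<iota> i) \<and> (\<Sum>i\<le>d. real (p i) * x $ \<iota> i) = real q}" (is "_ = ?S")
proof
  have inj: "inj_on \<iota> {..d}" using assms(1) by (simp add: bij_betw_def)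
  have "convex ?S"
  proof (rule convexI)
    fix x y :: "real ^ 'n" and u v :: real
    assume xy: "x \<in> ?S" "y \<in> ?S" and uv: "0 \<le> u" "0 \<le> v" "u + v = 1"
    have "(\<Sum>i\<le>d. real (p i) * (u * x $ \<iota> i + v * y $ \<iota> i)) =
        u * (\<Sum>i\<le>d. real (p i) * x $ \<iota> i) + v * (\<Sum>i\<le>d. real (p i) * y $ \<iota> i)"
      by (simp add: sum_distrib_left sum.distrib algebra_simps)
    also have "\<dots> = (u + v) * real q" using xy by (simp add: distrib_right)
    also have "\<dots> = real q" using uv by simp
    finally show "u *\<^sub>R x + v *\<^sub>R y \<in> ?S" using xy uv by simp
  qed
  moreover have "scaled_vertex \<iota> p q ` {..d} \<subseteq> ?S"
    using assms(2) by (auto simp: scaled_vertex_nth[OF inj] if_distrib[of "\<lambda>a. _ * a"] cong: if_cong)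
  ultimately show "convex hull (scaled_vertex \<iota> p q ` {..d}) \<subseteq> ?S"
    by (intro hull_minimal)
  show "?S \<subseteq> convex hull (scaled_vertex \<iota> p q ` {..d})"
  proof
    fix x assume x: "x \<in> ?S"
    \<comment> \<open>The weights are the barycentric coordinates of \<open>x\<close>; the defining
      equation makes them sum to 1.\<close>
    let ?y = "\<Sum>i\<le>d. (real (p i) * x $ \<iota> i / real q) *\<^sub>R scaled_vertex \<iota> p q i"
    have "?y \<in> convex hull (scaled_vertex \<iota> p q ` {..d})"
      using x assms(3) by (intro convex_sum) (auto simp: hull_inc simp flip: sum_divide_distrib)
    moreover have "?y = x"
    proof -
      have "?y $ \<iota> l = x $ \<iota> l" if "l \<le> d" for l
        using that assms(2,3)
        by (simp add: scaled_vertex_nth[OF inj] if_distrib[of "\<lambda>a. _ * a"] cong: if_cong)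
      then have "?y $ j = x $ j" if "j \<in> \<iota> ` {..d}" for j using that by fast
      then show ?thesis using assms(1) by (simp add: vec_eq_iff bij_betw_def)
    qed
    ultimately show "x \<in> convex hull (scaled_vertex \<iota> p q ` {..d})" by simp
  qed
qed

text \<open>The equation cuts out an affine set containing the vertices. Read with \<open>j\<close>
  for \<open>d\<close>, it concerns the face on the first \<open>j + 1\<close> vertices.\<close>

lemma affine_hull_scaled_vertices:
  fixes \<iota> :: "nat \<Rightarrow> 'n::finite"
  assumes "inj_on \<iota> {..d}" "\<forall>i\<le>d. p i > 0"
    and "x \<in> affine hull (scaled_vertex \<iota> p q ` {..d})"
  shows "(\<Sum>i\<le>d. real (p i) * x $ \<iota> i) = real q"
proof -
  let ?S = "{x :: real ^ 'n. (\<Sum>i\<le>d. real (p i) * x $ \<iota> i) = real q}"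
  have "affine ?S"
    unfolding affine_def
  proof clarify
    fix x y :: "real ^ 'n" and u v :: real
    assume xy: "(\<Sum>i\<le>d. real (p i) * x $ \<iota> i) = real q"
      "(\<Sum>i\<le>d. real (p i) * y $ \<iota> i) = real q" and uv: "u + v = 1"
    have "(\<Sum>i\<le>d. real (p i) * (u * x $ \<iota> i + v * y $ \<iota> i)) =
        u * (\<Sum>i\<le>d. real (p i) * x $ \<iota> i) + v * (\<Sum>i\<le>d. real (p i) * y $ \<iota> i)"
      by (simp add: sum_distrib_left sum.distrib algebra_simps)
    also have "\<dots> = (u + v) * real q" using xy by (simp add: distrib_right)
    also have "\<dots> = real q" using uv by simp
    finally show "(\<Sum>i\<le>d. real (p i) * (u *\<^sub>R x + v *\<^sub>R y) $ \<iota> i) = real q" by simp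
  qed
  moreover have "scaled_vertex \<iota> p q ` {..d} \<subseteq> ?S"
    using assms(2) by (auto simp: scaled_vertex_nth[OF assms(1)] if_distrib[of "\<lambda>a. _ * a"] cong: if_cong)
  ultimately show ?thesis using assms(3) hull_minimal[of _ ?S affine] by blast
qed

lemma simplex_axis_simplex:
  assumes "inj_on \<iota> {..d}" "\<forall>i\<le>d. p i > 0"
  shows "int d simplex axis_simplex \<iota> d p"
proof -
  have "axis_simplex \<iota> d p = convex hull (scaled_vertex \<iota> p 1 ` {..d})"
    unfolding dilate_axis_simplex[symmetric] by (simp add: dilate_def)
  then show ?thesis
    using scaled_vertex_independent[OF assms, of 1] unfolding simplex_def
    by (intro exI[of _ "scaled_vertex \<iota> p 1 ` {..d}"]) (simp add: card_image)
qed

lemma lattice_count_axis_simplex: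
  fixes \<iota> :: "nat \<Rightarrow> 'n::finite"
  assumes bij: "bij_betw \<iota> {..d} UNIV" and "\<forall>i\<le>d. p i > 0" "k > 0"
  shows "lattice_count (axis_simplex \<iota> d p) k = num_representations p d k"
proof -
  define \<kappa> where "\<kappa> = the_inv_into {..d} \<iota>"
  have inj: "inj_on \<iota> {..d}" using bij by (simp add: bij_betw_def)
  have \<kappa>: "\<kappa> (\<iota> i) = i" if "i \<le> d" for i
    using that inj by (simp add: \<kappa>_def the_inv_into_f_f)
  have \<iota>: "\<exists>i\<le>d. j = \<iota> i" for j using bij by (auto simp: bij_betw_def)
  let ?g = "\<lambda>m::nat \<Rightarrow> nat. (\<chi> j. real (m (\<kappa> j))) :: real ^ 'n"
  have "dilate k (axis_simplex \<iota> d p) \<inter> integer_points = ?g ` representations p d k"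
    unfolding dilate_axis_simplex convex_hull_scaled_vertices[OF assms]
  proof safe
    fix x :: "real ^ 'n"
    assume x: "x \<in> integer_points" "\<forall>i\<le>d. 0 \<le> x $ \<iota> i"
      and sum: "(\<Sum>i\<le>d. real (p i) * x $ \<iota> i) = real k"
    \<comment> \<open>The coordinates are nonnegative integers, so the floor loses nothing; the
      default 0 beyond \<open>d\<close> matches \<open>representations\<close>.\<close>
    define m where "m i = (if i \<le> d then nat \<lfloor>x $ \<iota> i\<rfloor> else 0)" for i
    have m: "real (m i) = x $ \<iota> i" if "i \<le> d" for i
      using x that by (auto simp: m_def integer_points_def elim: Ints_cases)
    have "real (\<Sum>i\<le>d. p i * m i) = real k" using sum by (simp add: m)
    then have "m \<in> representations p d k"
      unfolding of_nat_eq_iff by (simp add: representations_def m_def)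
    moreover have "x = ?g m" using m \<kappa> \<iota> by (simp add: vec_eq_iff) metis
    ultimately show "x \<in> ?g ` representations p d k" by blast
  next
    fix m assume m: "m \<in> representations p d k"
    show "?g m \<in> integer_points" by (simp add: integer_points_def)
    have "real (\<Sum>i\<le>d. p i * m i) = real k" using m by (simp add: representations_def)
    then show "(\<Sum>i\<le>d. real (p i) * ?g m $ \<iota> i) = real k" by (simp add: \<kappa>)
  qed simp
  moreover have "inj_on ?g (representations p d k)"
  proof (rule inj_onI, rule ext)
    fix m m' i
    assume "m \<in> representations p d k" "m' \<in> representations p d k" "?g m = ?g m'"
    then show "m i = m' i"
      using \<kappa>[of i] by (cases "i \<le> d") (auto simp: representations_def vec_eq_iff dest: spec[of _ "\<iota> i"])
  qed
  ultimately show ?thesis by (simp add: lattice_count_def num_representations_def card_image)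
qed

text \<open>In the \<open>p j\<close>-fold dilate each \<open>j\<close>-face has an integral vertex;
  conversely, the face on vertices \<open>0, ..., j\<close> forces \<open>p j\<close> to divide any
  admissible \<open>q\<close>.\<close>

lemma j_index_axis_simplex:
  fixes \<iota> :: "nat \<Rightarrow> 'n::finite"
  assumes inj: "inj_on \<iota> {..d}" and pos: "\<forall>i\<le>d. p i > 0" and dvd: "\<forall>i<d. p (Suc i) dvd p i"
    and "j \<le> d"
  shows "j_index (axis_simplex \<iota> d p) j = p j"
proof -
  have face_iff: "F face_of dilate q (axis_simplex \<iota> d p) \<and> aff_dim F = int j \<longleftrightarrow>
      (\<exists>I\<subseteq>{..d}. card I = Suc j \<and> F = convex hull (scaled_vertex \<iota> p q ` I))"
    if q: "q > 0" for q F
  proof -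
    note indep = scaled_vertex_independent[OF inj pos q]
    have dim: "aff_dim (convex hull (scaled_vertex \<iota> p q ` I)) = int (card I) - 1" if "I \<subseteq> {..d}" for I
      using aff_dim_affine_independent[of "scaled_vertex \<iota> p q ` I"]
        affine_independent_subset[OF indep(2) image_mono[OF that]]
        card_image[OF inj_on_subset[OF indep(1) that]] by (simp add: aff_dim_convex_hull)
    have "F face_of dilate q (axis_simplex \<iota> d p) \<longleftrightarrow>
        (\<exists>I\<subseteq>{..d}. F = convex hull (scaled_vertex \<iota> p q ` I))"
      unfolding dilate_axis_simplex face_of_convex_hull_affine_independent[OF indep(2)]
      by (auto simp: subset_image_iff)
    moreover have "int (card I) - 1 = int j \<longleftrightarrow> card I = Suc j" for I :: "nat set" by linarith
    ultimately show ?thesis by (auto simp: dim)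
  qed
  show ?thesis
    unfolding j_index_def
  proof (rule Least_equality, intro conjI allI impI)
    show "p j > 0" using pos \<open>j \<le> d\<close> by blast
    fix F assume "F face_of dilate (p j) (axis_simplex \<iota> d p) \<and> aff_dim F = int j"
    then obtain I where I: "I \<subseteq> {..d}" "card I = Suc j"
      "F = convex hull (scaled_vertex \<iota> p (p j) ` I)"
      using face_iff[OF \<open>p j > 0\<close>] by blast
    \<comment> \<open>Since \<open>j + 1\<close> indices cannot all lie below \<open>j\<close>, some
      vertex has index \<open>m \<ge> j\<close>, and its nonzero coordinate \<open>p j / p m\<close>
      is an integer.\<close>
    have "\<not> I \<subseteq> {..<j}" using card_mono[of "{..<j}" I] I(2) by auto
    then obtain m where m: "m \<in> I" "j \<le> m" using not_less by blast
    then have "p m dvd p j" using I(1) dvd by (intro dvd_chain) auto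
    then have "scaled_vertex \<iota> p (p j) m \<in> integer_points"
      by (auto simp: integer_points_def scaled_vertex_def axis_def elim!: dvdE)
    moreover have "scaled_vertex \<iota> p (p j) m \<in> affine hull F"
      using m(1) by (simp add: I(3) affine_hull_convex_hull hull_inc)
    ultimately show "affine hull F \<inter> integer_points \<noteq> {}" by blast
  next
    fix q
    assume q: "q > 0 \<and> (\<forall>F. F face_of dilate q (axis_simplex \<iota> d p) \<and> aff_dim F = int j \<longrightarrow>
      affine hull F \<inter> integer_points \<noteq> {})"
    have "convex hull (scaled_vertex \<iota> p q ` {..j}) face_of dilate q (axis_simplex \<iota> d p) \<and>
        aff_dim (convex hull (scaled_vertex \<iota> p q ` {..j})) = int j"
      unfolding face_iff[OF conjunct1[OF q]] using \<open>j \<le> d\<close>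
      by (intro exI[of _ "{..j}"]) auto
    then obtain x where x: "x \<in> affine hull (scaled_vertex \<iota> p q ` {..j})" "x \<in> integer_points"
      using q by (metis affine_hull_convex_hull disjoint_iff)
    \<comment> \<open>At an integer point this equation writes \<open>q\<close> as an integer
      combination of \<open>p 0, ..., p j\<close>, all divisible by \<open>p j\<close>.\<close>
    have "(\<Sum>i\<le>j. real (p i) * x $ \<iota> i) = real q"
      using x(1) \<open>j \<le> d\<close> pos by (intro affine_hull_scaled_vertices inj_on_subset[OF inj]) auto
    moreover obtain z where "\<And>i. x $ i = of_int (z i)"
      using x(2) unfolding integer_points_def Ints_def mem_Collect_eq image_iff by metis
    ultimately have "real_of_int (\<Sum>i\<le>j. int (p i) * z (\<iota> i)) = of_int (int q)" by simp
    then have "(\<Sum>i\<le>j. int (p i) * z (\<iota> i)) = int q" unfolding of_int_eq_iff .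
    moreover have "int (p j) dvd (\<Sum>i\<le>j. int (p i) * z (\<iota> i))"
      using dvd_chain[OF dvd _ \<open>j \<le> d\<close>] by (intro dvd_sum dvd_mult2) auto
    ultimately show "p j \<le> q" using q by (auto dest: dvd_imp_le)
  qed
qed

theorem theorem2:
  fixes d :: nat and p :: "nat \<Rightarrow> nat" and \<iota> :: "nat \<Rightarrow> 'n::finite"
  assumes "bij_betw \<iota> {0..d} UNIV"
    and "\<forall>i\<le>d. p i > 0"
    and "inj_on p {0..d}"
    and "\<forall>i<d. p (Suc i) dvd p i"
  shows "int d simplex axis_simplex \<iota> d p \<and>
    (\<exists>c. ehrhart_coeffs (axis_simplex \<iota> d p) d c) \<and>
    (\<forall>c. ehrhart_coeffs (axis_simplex \<iota> d p) d c \<longrightarrow> (\<forall>j\<le>d. min_period (c j) = p j)) \<and>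
    (\<forall>j\<le>d. j_index (axis_simplex \<iota> d p) j = p j)"
proof -
  let ?\<Delta> = "axis_simplex \<iota> d p"
  have bij: "bij_betw \<iota> {..d} UNIV" and inj: "inj_on \<iota> {..d}"
    using assms(1) by (simp_all add: atMost_atLeast0 bij_betw_def)
  note count = lattice_count_axis_simplex[OF bij assms(2)]
  obtain c where "\<forall>j\<le>d. periodic (c j)"
    "\<And>k. of_nat (num_representations p d k) = (\<Sum>j\<le>d. c j (int k) * of_nat k ^ j)"
    using num_representations_quasi_poly[OF assms(2,4)] by blast
  then have "ehrhart_coeffs ?\<Delta> d c" by (simp add: ehrhart_coeffs_def count)
  moreover have "min_period (c j) = p j" if "ehrhart_coeffs ?\<Delta> d c" "j \<le> d" for c j
    using coeff_periods_num_representations[OF assms(2,4,3), of c j] that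
    by (auto simp: ehrhart_coeffs_def count intro!: min_period_eqI)
  ultimately show ?thesis
    using simplex_axis_simplex[OF inj assms(2)] j_index_axis_simplex[OF inj assms(2,4)] by blast
qed

end
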